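(* For every positive integer $n > 21$ there is an integer $x > 1$ such that $2^x - 1 \in Z_n^*$.
   Context: For a positive integer $n$, $Z_n^* = \{x \in \mathbb{N} \mid 1 \leq x < n, \gcd(x,n) = 1\}$ is a set of actual integers (not residue classes); in particular $2^x-1 \in Z_n^*$ requires $2^x - 1 < n$. *)

theory Defs
  imports Main
begin

(* Actual natural numbers rather than residue classes. The upper bound is strict, so
   Z_star 1 = {}, unlike the library's totatives 1 = {1}; the two agree for all other n. *)
definition Z_star :: "nat \<Rightarrow> nat set" where
  "Z_star n = {x. 1 \<le> x \<and> x < n \<and> gcd x n = 1}"

end

theory Submission
  imports Defs "HOL-Number_Theory.Number_Theory" "HOL-Library.Discrete_Functions"
begin

text \<open>Suppose that no Mersenne number \<open>2 ^ x - 1 < n\<close> with \<open>x > 1\<close> is coprime to \<open>n\<close>. For every prime \<open>p\<close> with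
\<open>2 ^ p \<le> n\<close> the numbers \<open>n\<close> and \<open>2 ^ p - 1\<close> then share a prime factor \<open>q\<close>. The order of 2 modulo \<open>q\<close> is
\<open>p\<close>. So different \<open>p\<close> give different \<open>q\<close>, and \<open>p\<close> divides \<open>q - 1\<close>, which gives \<open>q \<ge> 2p + 1\<close> for odd \<open>p\<close>.
For \<open>p = 2\<close> the factor is 3, and for some small \<open>p\<close> the number \<open>2 ^ p - 1\<close> is itself prime and equal to \<open>q\<close>.
With \<open>2 ^ L \<le> n < 2 ^ (L + 1)\<close>, the product of these lower bounds over all primes \<open>p \<le> L\<close> is at most
\<open>n\<close> (lemma \<open>prod_factor_bound_le\<close>). This is impossible: the primes up to \<open>L\<close> alone have a product of
size about \<open>exp L\<close>, and the extra factors 2 only help.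

An elementary estimate in place of the prime number theorem has to settle the second claim. The
largest prime powers up to \<open>L\<close> have a product \<open>D \<ge> 2 ^ (L - 1)\<close> (lemma \<open>prod_prime_powers_ge\<close>), as
this product is a common multiple of \<open>1, \<dots>, L\<close>. Replacing prime powers by primes costs something
only for primes up to the square root of \<open>L\<close>, and this loss is outweighed by the factors 2 from all
the others, whose number is bounded below by the same estimate of \<open>D\<close>. For \<open>L \<ge> 400\<close> this makes the
product at least \<open>2 ^ (L + 1) > n\<close> (lemma \<open>prod_factor_bound_ge\<close>).

Smaller \<open>n\<close> are excluded by climbing (lemma \<open>obstructed_ge_power_400\<close>): the factors found so far give
a lower bound for \<open>n\<close>, this bound admits new exponents \<open>p\<close>, and these supply new factors. Starting from
the exponents 2, 3 and 5, the climb passes \<open>2 ^ 400\<close>.\<close>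

section \<open>Prime factors of Mersenne numbers\<close>

lemma composite_has_small_prime_factor:
  fixes m :: nat
  assumes "1 < m" "\<not> prime m"
  shows "\<exists>p. prime p \<and> p dvd m \<and> p\<^sup>2 \<le> m"
proof -
  obtain a where a: "a dvd m" "a \<noteq> 1" "a \<noteq> m"
    using assms by (auto simp: prime_nat_iff)
  then obtain b where ab: "m = a * b" by blast
  have gt: "1 < min a b" using a ab assms(1) by (cases a; cases b) auto
  then have "min a b \<noteq> 1" by linarith
  then obtain p where p: "prime p" "p dvd min a b"
    using prime_factor_nat by blast
  have "p \<le> min a b" using p(2) gt by (intro dvd_imp_le) auto
  then have "p * p \<le> a * b" by (intro mult_le_mono) auto
  moreover have "p dvd m" using p(2) ab by (auto simp: min_def split: if_splits)
  ultimately show ?thesis using p(1) ab by (auto simp: power2_eq_square)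
qed

text \<open>The bound is the square of 17, the next prime after the trial divisors.\<close>
lemma prime_if_less_289:
  fixes m :: nat
  assumes "1 < m" "m < 289" "\<forall>d\<in>{2, 3, 5, 7, 11, 13}. d dvd m \<longrightarrow> d = m"
  shows "prime m"
proof (rule ccontr)
  assume "\<not> prime m"
  then obtain p where p: "prime p" "p dvd m" "p\<^sup>2 \<le> m"
    using composite_has_small_prime_factor assms(1) by blast
  have "p\<^sup>2 < 17\<^sup>2" using p(3) assms(2) by simp
  then have "p < 17" by (rule power_less_imp_less_base) simp
  moreover have "2 \<le> p" using p(1) by (rule prime_ge_2_nat)
  ultimately have "p \<in> {2, 3, 5, 7, 11, 13} \<or> p \<in> {4, 6, 8, 9, 10, 12, 14, 15, 16}"
    unfolding insert_iff empty_iff by presburger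
  then have "p \<in> {2, 3, 5, 7, 11, 13}" using p(1) by auto
  then show False using assms(3) p \<open>\<not> prime m\<close> by blast
qed

text \<open>This fact is used twice: the order divides \<open>q - 1\<close>, so it makes \<open>q\<close> large compared with \<open>p\<close>,
and it recovers \<open>p\<close> from \<open>q\<close>, so that different exponents give different primes.\<close>
lemma ord_2_eq_exponent:
  fixes p q :: nat
  assumes "prime p" "prime q" "q dvd 2 ^ p - 1"
  shows "ord q 2 = p"
proof -
  have "[2 ^ p = 1] (mod q)"
    using assms(3) cong_altdef_nat[of 1 "2 ^ p" q] by (simp add: cong_sym_eq)
  then have "ord q 2 dvd p" by (simp only: ord_divides)
  moreover have "ord q 2 \<noteq> 1"
  proof
    assume "ord q 2 = 1"
    then have "[2 ^ 1 = 1] (mod q)" by (simp only: ord_divides) simp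
    then have "q dvd 1" using cong_altdef_nat[of 1 2 q] by (simp add: cong_sym_eq)
    then show False using assms(2) by simp
  qed
  ultimately show ?thesis using assms(1) prime_nat_iff by blast
qed

lemma prime_factor_of_mersenne_cong_1:
  fixes p q :: nat
  assumes "prime p" "p > 2" "prime q" "q dvd 2 ^ p - 1"
  shows "2 * p dvd q - 1"
proof -
  have "odd p" using assms(1,2) by (simp add: prime_odd_nat)
  have "odd (2 ^ p - 1 :: nat)" using \<open>p > 2\<close> by simp
  then have "odd q" using assms(4) dvd_trans by blast
  then have "coprime q 2" by simp
  then have "p dvd totient q"
    using order_divides_totient[of q 2] ord_2_eq_exponent[OF assms(1,3,4)] by simp
  then have "p dvd q - 1" using assms(3) by (simp add: totient_prime)
  moreover have "2 dvd q - 1" using \<open>odd q\<close> by simp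
  moreover have "coprime 2 p" using \<open>odd p\<close> by simp
  ultimately show ?thesis by (simp add: divides_mult)
qed

text \<open>Trial division restricted to the candidates \<open>2pk + 1\<close>, the only numbers that can be prime factors
of \<open>2 ^ p - 1\<close>. This leaves at most nineteen divisions for each exponent below.\<close>
lemma mersenne_prime_if_no_small_factor:
  fixes p K :: nat
  assumes "prime p" "p > 2" "2 ^ p - 1 < (2 * p * K + 1)\<^sup>2"
    and "\<forall>k\<in>set [1..<K]. \<not> 2 * p * k + 1 dvd 2 ^ p - 1"
  shows "prime (2 ^ p - 1 :: nat)"
proof (rule ccontr)
  assume "\<not> prime (2 ^ p - 1 :: nat)"
  moreover have "(1::nat) < 2 ^ p - 1"
  proof -
    have "(2::nat) ^ 2 \<le> 2 ^ p" using assms(2) by (intro power_increasing) auto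
    then show ?thesis by simp
  qed
  ultimately obtain q :: nat where q: "prime q" "q dvd 2 ^ p - 1" "q\<^sup>2 \<le> 2 ^ p - 1"
    using composite_has_small_prime_factor by blast
  obtain k where "q - 1 = 2 * p * k"
    using prime_factor_of_mersenne_cong_1[OF assms(1,2) q(1,2)] by blast
  then have k: "q = 2 * p * k + 1" using prime_gt_1_nat[OF q(1)] by simp
  have "q\<^sup>2 < (2 * p * K + 1)\<^sup>2" using q(3) assms(3) by linarith
  then have "q < 2 * p * K + 1" by (rule power_less_imp_less_base) simp
  then have "k < K" using k by simp
  moreover have "k > 0" using k q(1) by (cases k) auto
  ultimately show False using assms(4) q(2) k by auto
qed

lemma small_mersenne_primes:
  assumes "p \<in> {2, 3, 5, 7, 13, 17, 19}"
  shows "prime (2 ^ p - 1 :: nat)"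
proof -
  have "prime (2 ^ 2 - 1 :: nat)" by simp
  moreover have "prime (2 ^ 3 - 1 :: nat)"
    by (rule mersenne_prime_if_no_small_factor[where K = 1]) simp_all
  moreover have "prime (2 ^ 5 - 1 :: nat)"
    by (rule mersenne_prime_if_no_small_factor[where K = 1]) simp_all
  moreover have "prime (2 ^ 7 - 1 :: nat)"
    by (rule mersenne_prime_if_no_small_factor[where K = 1]) simp_all
  moreover have "prime (2 ^ 13 - 1 :: nat)"
    by (rule mersenne_prime_if_no_small_factor[where K = 4]) (simp_all add: upt_rec)
  moreover have "prime (2 ^ 17 - 1 :: nat)"
    by (rule mersenne_prime_if_no_small_factor[where K = 11]) (simp_all add: upt_rec)
  moreover have "prime (2 ^ 19 - 1 :: nat)"
    by (rule mersenne_prime_if_no_small_factor[where K = 20]) (simp_all add: upt_rec)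
  ultimately show ?thesis using assms by blast
qed

text \<open>A lower bound for the prime factors of \<open>2 ^ p - 1\<close>. For the exponents listed the number is itself a
Mersenne prime; taking its full value here, instead of only \<open>2p + 1\<close>, raises the product over the
primes up to 19 above \<open>2 ^ 69\<close>, and this makes up for the crude estimates for the small primes in the
asymptotic argument.\<close>
definition factor_bound :: "nat \<Rightarrow> nat" where
  "factor_bound p = (if p \<in> {2, 3, 5, 7, 13, 17, 19} then 2 ^ p - 1 else 2 * p + 1)"

lemma factor_bound_le_prime_factor:
  assumes "prime p" "prime q" "q dvd 2 ^ p - 1"
  shows "factor_bound p \<le> q"
proof (cases "p \<in> {2, 3, 5, 7, 13, 17, 19}")
  case True
  have "prime (2 ^ p - 1 :: nat)" using True by (rule small_mersenne_primes)
  then have "q = 2 ^ p - 1" using assms primes_dvd_imp_eq by blast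
  then show ?thesis using True by (simp add: factor_bound_def)
next
  case False
  have "p > 2" using False prime_ge_2_nat[OF assms(1)] by auto
  then have "2 * p dvd q - 1" using prime_factor_of_mersenne_cong_1 assms by blast
  moreover have "q - 1 > 0" using prime_gt_1_nat[OF assms(2)] by simp
  ultimately have "2 * p \<le> q - 1" by (rule dvd_imp_le)
  then show ?thesis using False \<open>q - 1 > 0\<close> by (simp add: factor_bound_def)
qed

section \<open>Counterexamples have many prime factors\<close>

text \<open>Restricted to prime exponents, because these give pairwise coprime Mersenne numbers.\<close>
definition obstructed :: "nat \<Rightarrow> bool" where
  "obstructed n \<longleftrightarrow> (\<forall>p. prime p \<longrightarrow> 2 ^ p \<le> n \<longrightarrow> \<not> coprime (2 ^ p - 1) n)"

lemma prod_prime_factors_dvd: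
  fixes n :: nat
  assumes "n > 0"
  shows "\<Prod>(prime_factors n) dvd n"
proof -
  have "\<Prod>(prime_factors n) dvd (\<Prod>p\<in>prime_factors n. p ^ multiplicity p n)"
    by (rule prod_dvd_prod) (auto simp: prime_factors_multiplicity)
  also have "\<dots> = n" using assms prime_factorization_nat[of n] by simp
  finally show ?thesis .
qed

text \<open>Choosing for each exponent \<open>p\<close> a common prime factor of \<open>2 ^ p - 1\<close> and \<open>n\<close> is injective, since \<open>p\<close> is
the order of 2 modulo the chosen prime. So the product of the chosen primes still divides \<open>n\<close>.\<close>
lemma prod_factor_bound_le:
  assumes "obstructed n" "finite A" "\<And>p. p \<in> A \<Longrightarrow> prime p" "\<And>p. p \<in> A \<Longrightarrow> 2 ^ p \<le> n" "n > 0"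
  shows "prod factor_bound A \<le> n"
proof -
  have "\<exists>q. prime q \<and> q dvd 2 ^ p - 1 \<and> q dvd n" if "p \<in> A" for p
  proof -
    have "\<not> coprime (2 ^ p - 1) n"
      using assms(1) assms(3)[OF that] assms(4)[OF that] by (simp add: obstructed_def)
    then have "gcd (2 ^ p - 1) n \<noteq> 1" using coprime_iff_gcd_eq_1 by blast
    then obtain q where "prime q" "q dvd gcd (2 ^ p - 1) n" using prime_factor_nat by blast
    then show ?thesis by auto
  qed
  then obtain q where q: "\<And>p. p \<in> A \<Longrightarrow> prime (q p) \<and> q p dvd 2 ^ p - 1 \<and> q p dvd n"
    by metis
  have inj: "inj_on q A"
    by (rule inj_on_inverseI[where g = "\<lambda>r. ord r 2"]) (use q assms(3) ord_2_eq_exponent in blast)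
  have "prod factor_bound A \<le> prod q A"
    using q assms(3) factor_bound_le_prime_factor by (intro prod_mono) auto
  also have "prod q A = \<Prod>(q ` A)" using inj by (simp add: prod.reindex)
  also have "\<dots> \<le> n"
  proof (rule dvd_imp_le)
    have "q ` A \<subseteq> prime_factors n" using q assms(5) by (auto simp: prime_factors_dvd)
    then have "\<Prod>(q ` A) dvd \<Prod>(prime_factors n)" by (intro prod_dvd_prod_subset) auto
    then show "\<Prod>(q ` A) dvd n" using prod_prime_factors_dvd[OF assms(5)] dvd_trans by blast
  qed (use assms in simp)
  finally show ?thesis .
qed

text \<open>Bootstrapping a lower bound: a counterexample that is at least \<open>c \<ge> 2 ^ p\<close> must also have a factor
from the exponent \<open>p\<close>, which improves the bound. The test \<open>2 ^ p \<le> c\<close> stops the climb as soon as the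
bound no longer justifies the next exponent.\<close>
fun climb :: "nat \<Rightarrow> nat list \<Rightarrow> nat" where
  "climb c [] = c"
| "climb c (p # ps) = (if 2 ^ p \<le> c then climb (c * factor_bound p) ps else c)"

lemma climb_le:
  assumes "obstructed n" "n > 0" "finite A" "\<And>p. p \<in> A \<Longrightarrow> prime p" "\<And>p. p \<in> A \<Longrightarrow> 2 ^ p \<le> n"
    and "\<And>p. p \<in> set ps \<Longrightarrow> prime p" "distinct ps" "A \<inter> set ps = {}"
  shows "climb (prod factor_bound A) ps \<le> n"
  using assms(3-)
proof (induction ps arbitrary: A)
  case Nil
  then show ?case using prod_factor_bound_le[OF assms(1)] assms(2) by simp
next
  case (Cons p ps)
  have le: "prod factor_bound A \<le> n"
    using Cons.prems prod_factor_bound_le[OF assms(1)] assms(2) by simp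
  show ?case
  proof (cases "2 ^ p \<le> prod factor_bound A")
    case True
    have "climb (prod factor_bound (insert p A)) ps \<le> n"
      by (rule Cons.IH) (use Cons.prems True le in auto)
    moreover have "prod factor_bound (insert p A) = prod factor_bound A * factor_bound p"
      using Cons.prems by (simp add: mult.commute)
    ultimately show ?thesis using True by simp
  qed (use le in simp)
qed

text \<open>The exponents 2 and 3 alone give only \<open>n \<ge> 21\<close>, which does not reach \<open>2 ^ 5\<close>. But they make \<open>n\<close> a
multiple of 21, so the next possible value after 21 is 42, and from there every prime exponent
comes into reach in turn. This is where \<open>n > 21\<close> enters: 21 itself is an exception.\<close>
lemma obstructed_ge_power_400:
  assumes "obstructed n" "n > 21"
  shows "2 ^ 400 \<le> n"
proof -
  have "\<not> coprime (2 ^ 2 - 1) n" "\<not> coprime (2 ^ 3 - 1) n"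
    using assms unfolding obstructed_def by (auto dest: spec[of _ 2] spec[of _ 3])
  then have "\<not> coprime 3 n" "\<not> coprime 7 n" by simp_all
  then have "3 dvd n" "7 dvd n"
    using prime_imp_coprime[of 3 n] prime_imp_coprime[of 7 n] by auto
  then have "n \<ge> 32" using assms(2) by presburger
  define ps :: "nat list" where "ps =
    [7, 11, 13, 17, 19, 23, 29, 31, 37, 41, 43, 47, 53, 59, 61, 67, 71, 73, 79, 83, 89, 97, 101,
     103, 107, 109, 113, 127, 131, 137, 139, 149, 151, 157, 163, 167, 173, 179, 181, 191, 193, 197,
     199, 211, 223, 227, 229, 233]"
  \<comment> \<open>The exponents stop at 233, the first prime whose factor pushes the bound beyond \<open>2 ^ 400\<close>.\<close>
  have "prime p" if "p \<in> set ps" for p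
    by (rule prime_if_less_289) (use that in \<open>auto simp: ps_def\<close>)
  moreover have "distinct ps" "{2, 3, 5} \<inter> set ps = {}" by (simp_all add: ps_def)
  moreover have "prime p \<and> 2 ^ p \<le> n" if "p \<in> {2, 3, 5}" for p :: nat
    using that \<open>n \<ge> 32\<close> by auto
  ultimately have "climb (prod factor_bound {2, 3, 5}) ps \<le> n"
    using assms by (intro climb_le) auto
  moreover have "2 ^ 400 \<le> climb (prod factor_bound {2, 3, 5}) ps"
    by (simp add: ps_def factor_bound_def)
  ultimately show ?thesis by (rule order_trans[rotated])
qed

section \<open>A Chebyshev-type lower bound for primes\<close>

text \<open>Leibniz's harmonic triangle: the numbers \<open>a(n, k) = 1 / (k * (n choose k))\<close> satisfy \<open>a(n, 1) = 1 / n\<close>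
and \<open>a(n, k + 1) = a(n - 1, k) - a(n, k)\<close>, so each is an integer combination of the reciprocals of
\<open>1, \<dots>, n\<close>, and a common multiple \<open>D\<close> of these numbers makes \<open>D * a(n, k)\<close> an integer.\<close>
lemma times_binomial_dvd_common_multiple:
  fixes D N :: nat
  assumes D: "\<And>i. 1 \<le> i \<Longrightarrow> i \<le> N \<Longrightarrow> i dvd D"
  shows "1 \<le> k \<Longrightarrow> k \<le> n \<Longrightarrow> n \<le> N \<Longrightarrow> k * (n choose k) dvd D"
proof (induction k arbitrary: n rule: nat_induct_at_least)
  case base
  then show ?case using D by simp
next
  case (Suc k)
  define x y z where "x = k * ((n - 1) choose k)" and "y = k * (n choose k)"
    and "z = Suc k * (n choose Suc k)"
  have z: "z = n * ((n - 1) choose k)"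
    using times_binomial_minus1_eq[of "Suc k" n] by (simp add: z_def)
  have zx: "k * z = n * x" by (simp add: z x_def)
  have zy: "k * z = (n - k) * y"
    using binomial_absorb_comp[of n k] by (simp add: z y_def)
  have "x dvd D" "y dvd D" unfolding x_def y_def using Suc by auto
  then obtain u v where u: "D = x * u" and v: "D = y * v" by (meson dvdE)
  \<comment> \<open>The recurrence \<open>1/z = 1/x - 1/y\<close>, cleared of denominators: \<open>D / z = u - v\<close>.\<close>
  have "k * (z * (u - v)) = k * z * u - k * z * v"
    by (simp add: diff_mult_distrib2 mult.assoc)
  also have "k * z * u = n * D" by (simp add: zx u mult.assoc)
  also have "k * z * v = (n - k) * D" by (simp add: zy v mult.assoc)
  also have "n * D - (n - k) * D = k * D"
    using Suc.prems by (simp flip: diff_mult_distrib)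
  finally have "D = z * (u - v)" using Suc.hyps by simp
  then show ?case unfolding z_def by (rule dvdI)
qed

text \<open>The numbers \<open>k * (L choose k)\<close> with \<open>1 \<le> k \<le> L\<close> have mean \<open>2 ^ (L - 1)\<close>, and \<open>D\<close> is at least as
large as each of them.\<close>
lemma common_multiple_ge_power_2:
  fixes D L :: nat
  assumes "\<And>i. 1 \<le> i \<Longrightarrow> i \<le> L \<Longrightarrow> i dvd D" "D > 0" "L > 0"
  shows "2 ^ (L - 1) \<le> D"
proof -
  have "L * 2 ^ (L - 1) = (\<Sum>k\<le>L. k * (L choose k))" by (simp add: choose_linear_sum)
  also have "\<dots> = (\<Sum>k\<in>{1..L}. k * (L choose k))"
    by (rule sum.mono_neutral_right) auto
  also have "\<dots> \<le> (\<Sum>k\<in>{1..L}. D)"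
    using times_binomial_dvd_common_multiple[OF assms(1)] assms(2)
    by (intro sum_mono dvd_imp_le) auto
  also have "\<dots> = L * D" by simp
  finally show ?thesis using assms(3) by simp
qed

text \<open>The product is a common multiple of \<open>1, \<dots>, L\<close>, because no prime power that divides such a number can
exceed the power in the product.\<close>
lemma prod_prime_powers_ge:
  assumes "L > 0" "\<And>p. prime p \<Longrightarrow> L < p ^ Suc (e p)"
  shows "2 ^ (L - 1) \<le> (\<Prod>p | prime p \<and> p \<le> L. p ^ e p)"
proof (rule common_multiple_ge_power_2)
  show "i dvd (\<Prod>p | prime p \<and> p \<le> L. p ^ e p)" if i: "1 \<le> i" "i \<le> L" for i
  proof -
    have "i = (\<Prod>p\<in>prime_factors i. p ^ multiplicity p i)"
      using prime_factorization_nat i by simp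
    also have "\<dots> dvd (\<Prod>p | prime p \<and> p \<le> L. p ^ e p)"
    proof (rule prod_dvd_prod_subset2)
      show "prime_factors i \<subseteq> {p. prime p \<and> p \<le> L}"
        using i by (auto simp: in_prime_factors_iff intro: order_trans[OF dvd_imp_le])
      show "p ^ multiplicity p i dvd p ^ e p" if "p \<in> prime_factors i" for p
      proof (rule le_imp_power_dvd, rule ccontr)
        have "prime p" using that by (simp add: in_prime_factors_iff)
        assume "\<not> multiplicity p i \<le> e p"
        then have "p ^ Suc (e p) \<le> p ^ multiplicity p i"
          using prime_gt_0_nat[OF \<open>prime p\<close>] by (intro power_increasing) auto
        also have "\<dots> \<le> i" using i by (intro dvd_imp_le multiplicity_dvd) auto
        finally show False using assms(2)[OF \<open>prime p\<close>] i by simp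
      qed
    qed simp
    finally show ?thesis .
  qed
  show "(\<Prod>p | prime p \<and> p \<le> L. p ^ e p) > 0"
    by (intro prod_pos) (auto simp: prime_gt_0_nat)
qed (use assms in simp)

text \<open>Primes above 19 are odd and different from 21, so they lie among the odd numbers from 23 on.\<close>
lemma card_primes_between:
  assumes "s \<ge> 20"
  shows "2 * card {p::nat. prime p \<and> 19 < p \<and> p \<le> s} + 20 \<le> s"
proof -
  have "{p::nat. prime p \<and> 19 < p \<and> p \<le> s} \<subseteq> (\<lambda>i. 2 * i + 1) ` {11..(s - 1) div 2}"
  proof
    fix p assume p: "p \<in> {p::nat. prime p \<and> 19 < p \<and> p \<le> s}"
    then have "odd p" by (auto simp: prime_odd_nat)
    moreover have "p \<noteq> 21" using p by auto
    ultimately have "p = 2 * (p div 2) + 1" "p div 2 \<in> {11..(s - 1) div 2}"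
      using p by auto presburger+
    then show "p \<in> (\<lambda>i. 2 * i + 1) ` {11..(s - 1) div 2}" by blast
  qed
  then have "card {p::nat. prime p \<and> 19 < p \<and> p \<le> s} \<le> card {11..(s - 1) div 2}"
    by (rule surj_card_le[rotated]) simp
  then show ?thesis using assms by simp
qed

section \<open>The exponents balance\<close>

lemma quartic_less_power_2:
  fixes j :: nat
  assumes "j \<ge> 13"
  shows "(int j * (int j - 4))\<^sup>2 < 2 * 2 ^ j"
  using assms
proof (induction j rule: nat_induct_at_least)
  case base
  then show ?case by simp
next
  case (Suc j)
  have "(int (Suc j) * (int (Suc j) - 4))\<^sup>2 \<le> 2 * (int j * (int j - 4))\<^sup>2"
  proof -
    \<comment> \<open>Expanded around 13, the difference of the two sides has only nonnegative coefficients.\<close>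
    define t where "t = int j - 13"
    have j: "int j = t + 13" "t \<ge> 0" using Suc.hyps by (simp_all add: t_def)
    have "0 \<le> t ^ 4" "0 \<le> t ^ 3" "0 \<le> t ^ 2" using j by simp_all
    then show ?thesis using j(2) by (simp add: j(1) power2_eq_square power3_eq_cube power4_eq_xxxx algebra_simps)
  qed
  then show ?case using Suc.IH by simp
qed

text \<open>Written in powers of two, the final estimate gains at least as much as it loses.
In its use \<open>N\<close> is the number of primes up to \<open>L\<close>, \<open>s\<close> the
integer square root of \<open>L\<close>, \<open>8 + a\<close> the number of primes up to \<open>s\<close>, and \<open>2 ^ j\<close> the least power of
two above \<open>L\<close>. If the inequality fails, the bounds on \<open>L\<close> and \<open>a\<close> give \<open>2 L\<close> at most
\<open>j (j - 4) s\<close> plus a negative term. As \<open>s\<close> is at most the square root of \<open>L\<close>, this forces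
\<open>L\<close> to be at most of order \<open>j ^ 4\<close>, while \<open>L\<close> is at least \<open>2 ^ (j - 1)\<close>. For \<open>j \<ge> 13\<close> this is
absurd even without the negative term; the four remaining values of \<open>j\<close> need it.\<close>
lemma exponent_inequality:
  fixes L N a s j :: nat
  assumes "L \<le> j * N + 1" "s\<^sup>2 \<le> L" "2 ^ j \<le> 2 * L" "2 * a + 20 \<le> s" "j \<ge> 9"
  shows "(j + 1) * (8 + a) \<le> 67 + 5 * a + N"
proof (rule ccontr)
  assume "\<not> ?thesis"
  then have N: "int N \<le> 8 * int j - 60 + int a * (int j - 4)"
    by (simp add: not_le algebra_simps) (auto simp flip: of_nat_mult of_nat_add)
  have "2 * int L \<le> 2 * (int j * int N + 1)"
    using assms(1) by (simp flip: of_nat_mult)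
  also have "\<dots> \<le> 2 * (int j * (8 * int j - 60 + int a * (int j - 4)) + 1)"
    using N by (simp add: mult_left_mono)
  also have "\<dots> = 2 + 16 * int j ^ 2 - 120 * int j + int j * (int j - 4) * (2 * int a)"
    by (simp add: power2_eq_square algebra_simps)
  also have "\<dots> \<le> 2 + 16 * int j ^ 2 - 120 * int j + int j * (int j - 4) * (int s - 20)"
    using assms(4,5) by (intro add_left_mono mult_left_mono) auto
  finally have L: "2 * int L \<le> 2 - 4 * int j ^ 2 - 40 * int j + int j * (int j - 4) * int s"
    by (simp add: power2_eq_square algebra_simps)
  have s: "int s * int s \<le> int L" using assms(2) by (simp add: power2_eq_square flip: of_nat_mult)
  show False
  proof (cases "j \<ge> 13")
    case True
    have neg: "2 - 4 * int j ^ 2 - 40 * int j \<le> 0"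
      using True zero_le_power2[of "int j"] by linarith
    have "2 * (int s * int s) \<le> int j * (int j - 4) * int s"
      using L s neg by linarith
    moreover have "int s > 0" using assms(4) by simp
    ultimately have "2 * int s \<le> int j * (int j - 4)"
      by (simp add: mult.assoc[symmetric])
    moreover have "2 * int L \<le> int j * (int j - 4) * int s"
      using L neg by linarith
    moreover have "0 \<le> int j * (int j - 4)" using True by simp
    ultimately have "2 * (2 * int L) \<le> (int j * (int j - 4)) * (int j * (int j - 4))"
      using mult_left_mono[of "2 * int s" "int j * (int j - 4)" "int j * (int j - 4)"] by linarith
    moreover have "2 ^ j \<le> 2 * int L" using assms(3) by (simp flip: of_nat_le_iff[where 'a = int])
    ultimately show False using quartic_less_power_2[OF True] by (simp add: power2_eq_square)
  next
    case False
    have L': "2 ^ j \<le> 2 * int L" using assms(3) by (simp flip: of_nat_le_iff[where 'a = int])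
    consider "j = 9" | "j = 10" | "j = 11" | "j = 12" using False assms(5) by linarith
    \<comment> \<open>For \<open>j \<le> 11\<close> the quadratic inequality in \<open>s\<close> has negative discriminant, and the square given is the
      one completed at its vertex. For \<open>j = 12\<close> it has real solutions, but \<open>L \<ge> 2048\<close> makes \<open>s\<close>
      larger than all of them.\<close>
    then show False
    proof cases
      case 1
      show False using L s zero_le_square[of "4 * int s - 45"] by (simp add: 1 algebra_simps)
    next
      case 2
      show False using L s zero_le_square[of "int s - 15"] by (simp add: 2 algebra_simps)
    next
      case 3
      show False using L s zero_le_square[of "4 * int s - 77"] by (simp add: 3 algebra_simps)
    next
      case 4
      have "int s \<ge> 50" using L L' by (simp add: 4)
      then have "50 * int s \<le> int s * int s" by (intro mult_right_mono) auto
      then show False using L s by (simp add: 4)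
    qed
  qed
qed

section \<open>The product of the factor bounds\<close>

text \<open>The product is compared with \<open>D = \<Prod> p ^ e p\<close>, where \<open>p ^ e p\<close> is the largest power of \<open>p\<close> up to \<open>L\<close>, so
that \<open>D \<ge> 2 ^ (L - 1)\<close>. Only a factor 4 is missing. For the primes in \<open>R\<close>, those above the square root
of \<open>L\<close>, the factor of \<open>D\<close> is just \<open>p\<close>, whereas the factor bound exceeds \<open>2p\<close>: each of these many primes
gains a factor 2. For the few primes in \<open>K\<close>, up to the square root, one may lose as much as \<open>L\<close>
divided by the factor bound. The gain wins because \<open>D \<le> L ^ N\<close> forces the number \<open>N\<close> of primes up to
\<open>L\<close> to be large.\<close>
lemma prod_factor_bound_ge:
  fixes L :: nat
  assumes "L \<ge> 400"
  shows "2 ^ (L + 1) \<le> (\<Prod>p | prime p \<and> p \<le> L. factor_bound p)"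
proof -
  define s where "s = floor_sqrt L"
  define P K R A where "P = {p::nat. prime p \<and> p \<le> L}" and "K = {p \<in> P. p \<le> s}"
    and "R = {p \<in> P. s < p}" and "A = {p::nat. prime p \<and> 19 < p \<and> p \<le> s}"
  define N a where "N = card P" and "a = card A"
  have s: "s\<^sup>2 \<le> L" "L < (s + 1)\<^sup>2"
    using Suc_floor_sqrt_power2_gt[of L] by (simp_all add: s_def)
  have "20 \<le> s" unfolding s_def using assms by (intro le_floor_sqrtI) simp
  have "s \<le> L" unfolding s_def by (rule floor_sqrt_le)
  have fin: "finite P" "finite K" "finite R" "finite A"
    by (simp_all add: P_def K_def R_def A_def)
  have PKR: "P = K \<union> R" "K \<inter> R = {}" by (auto simp: K_def R_def)
  have K: "K = {2, 3, 5, 7, 11, 13, 17, 19} \<union> A"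
  proof (intro equalityI subsetI)
    fix p assume "p \<in> K"
    then have p: "prime p" "p \<le> s" by (simp_all add: K_def P_def)
    have "p \<in> {2, 3, 5, 7, 11, 13, 17, 19} \<or> p \<in> {4, 6, 8, 9, 10, 12, 14, 15, 16, 18} \<or> 19 < p"
      using prime_ge_2_nat[OF p(1)] unfolding insert_iff empty_iff by presburger
    then show "p \<in> {2, 3, 5, 7, 11, 13, 17, 19} \<union> A"
      using p unfolding A_def by auto
  next
    fix p assume "p \<in> {2, 3, 5, 7, 11, 13, 17, 19} \<union> A"
    then have "prime p \<and> p \<le> s" using \<open>20 \<le> s\<close> unfolding A_def by auto
    then show "p \<in> K" using \<open>s \<le> L\<close> by (simp add: K_def P_def)
  qed
  have disj: "{2, 3, 5, 7, 11, 13, 17, 19} \<inter> A = {}" by (auto simp: A_def)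
  have cardK: "card K = 8 + a"
    unfolding K a_def using card_Un_disjoint[OF _ fin(4) disj] by simp
  have N: "N = 8 + a + card R"
    unfolding N_def PKR(1) using card_Un_disjoint[OF fin(2,3) PKR(2)] cardK by simp

  have "\<exists>e. p ^ e \<le> L \<and> L < p ^ Suc e" if "prime p" for p
    using ex_power_ivl1[OF prime_ge_2_nat[OF that], of L] assms by auto
  then obtain e where e: "\<And>p. prime p \<Longrightarrow> p ^ e p \<le> L" "\<And>p. prime p \<Longrightarrow> L < p ^ Suc (e p)"
    by metis
  have ge: "2 ^ (L - 1) \<le> (\<Prod>p\<in>P. p ^ e p)"
    unfolding P_def using assms e(2) by (intro prod_prime_powers_ge) auto

  obtain i where i: "2 ^ i \<le> L" "L < 2 ^ (i + 1)"
    using ex_power_ivl1[of 2 L] assms by auto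
  define j where "j = i + 1"
  have j: "L \<le> 2 ^ j" "2 ^ j \<le> 2 * L" using i by (simp_all add: j_def)
  have "j \<ge> 9"
  proof (rule ccontr)
    assume "\<not> j \<ge> 9"
    then have "2 ^ j \<le> (2::nat) ^ 8" by (intro power_increasing) auto
    then show False using j(1) assms by simp
  qed

  have "(2::nat) ^ (L - 1) \<le> (\<Prod>p\<in>P. 2 ^ j)"
    using e(1) j(1) by (intro order_trans[OF ge] prod_mono) (auto simp: P_def intro: order_trans)
  also have "\<dots> = 2 ^ (j * N)" by (simp add: N_def power_mult)
  finally have "L - 1 \<le> j * N" by simp
  then have "L \<le> j * N + 1" by simp
  moreover have "2 * a + 20 \<le> s"
    unfolding a_def A_def by (rule card_primes_between[OF \<open>20 \<le> s\<close>])
  ultimately have expo: "(j + 1) * (8 + a) \<le> 67 + 5 * a + N"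
    using exponent_inequality s(1) j(2) \<open>j \<ge> 9\<close> by blast

  have R_le: "p ^ e p \<le> p" if "p \<in> R" for p
  proof -
    have p: "prime p" "s < p" using that by (auto simp: R_def P_def)
    then have "(s + 1)\<^sup>2 \<le> p\<^sup>2" by (intro power_mono) auto
    then have "p ^ e p < p ^ 2" using s(2) e(1)[OF p(1)] by linarith
    then have "e p < 2" using power_less_imp_less_exp prime_gt_1_nat[OF p(1)] by blast
    then have "p ^ e p \<le> p ^ 1" using prime_gt_0_nat[OF p(1)] by (intro power_increasing) auto
    then show ?thesis by simp
  qed
  have "(\<Prod>p\<in>P. p ^ e p) = (\<Prod>p\<in>K. p ^ e p) * (\<Prod>p\<in>R. p ^ e p)"
    unfolding PKR(1) using fin PKR(2) by (simp add: prod.union_disjoint)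
  also have "\<dots> \<le> (\<Prod>p\<in>K. 2 ^ j) * \<Prod>R"
    using e(1) j(1) R_le
    by (intro mult_le_mono prod_mono) (auto simp: K_def P_def intro: order_trans)
  also have "(\<Prod>p\<in>K. 2 ^ j) = (2::nat) ^ (j * (8 + a))" by (simp add: cardK power_mult)
  finally have le: "2 ^ (L - 1) \<le> 2 ^ (j * (8 + a)) * \<Prod>R" using ge by simp

  \<comment> \<open>The eight primes up to 19 contribute \<open>2 ^ 69\<close>; every later one is at least 23 and so contributes
    more than \<open>2 ^ 5\<close>.\<close>
  have "2 ^ 69 * (\<Prod>p\<in>A. 2 ^ 5) \<le> prod factor_bound {2, 3, 5, 7, 11, 13, 17, 19} * prod factor_bound A"
    by (intro mult_le_mono prod_mono) (auto simp: A_def factor_bound_def)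
  also have "\<dots> = prod factor_bound K" unfolding K using fin disj by (simp only: prod.union_disjoint finite.intros)
  finally have fbK: "2 ^ (69 + 5 * a) \<le> prod factor_bound K" by (simp add: a_def power_add power_mult)
  have "(\<Prod>p\<in>R. 2 * p) \<le> prod factor_bound R"
    using \<open>20 \<le> s\<close> by (intro prod_mono) (auto simp: R_def factor_bound_def)
  then have fbR: "2 ^ card R * \<Prod>R \<le> prod factor_bound R" by (simp add: prod.distrib)

  \<comment> \<open>Multiplying the claim by \<open>2 ^ (j * (8 + a))\<close>, the bound for the part of \<open>D\<close> over \<open>K\<close>, avoids divisions.\<close>
  have "2 ^ (j * (8 + a)) * 2 ^ (L + 1) \<le> (2::nat) ^ (69 + 5 * a + card R + (L - 1))"
    unfolding power_add[symmetric] using expo N assms by (intro power_increasing) auto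
  also have "\<dots> = 2 ^ (69 + 5 * a) * 2 ^ card R * 2 ^ (L - 1)" by (simp only: power_add)
  also have "\<dots> \<le> 2 ^ (69 + 5 * a) * 2 ^ card R * (2 ^ (j * (8 + a)) * \<Prod>R)"
    using le by (intro mult_le_mono2)
  also have "\<dots> = 2 ^ (j * (8 + a)) * (2 ^ (69 + 5 * a) * (2 ^ card R * \<Prod>R))"
    by (simp only: ac_simps)
  also have "\<dots> \<le> 2 ^ (j * (8 + a)) * (prod factor_bound K * prod factor_bound R)"
    using fbK fbR by (intro mult_le_mono mult_le_mono2)
  also have "prod factor_bound K * prod factor_bound R = prod factor_bound P"
    unfolding PKR(1) using fin PKR(2) by (simp add: prod.union_disjoint)
  finally show ?thesis by (simp add: P_def)
qed

section \<open>Existence of a coprime Mersenne number\<close>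

theorem theorem3:
  fixes n :: nat
  assumes "n > 21"
  shows "\<exists>x::nat. x > 1 \<and> 2 ^ x - 1 \<in> Z_star n"
proof (rule ccontr)
  assume none: "\<not> ?thesis"
  have "obstructed n"
    unfolding obstructed_def
  proof (intro allI impI)
    fix p :: nat
    assume p: "prime p" "2 ^ p \<le> n"
    have "p > 1" using p(1) by (rule prime_gt_1_nat)
    then have "(2::nat) ^ 1 < 2 ^ p" by (intro power_strict_increasing) auto
    then have "1 \<le> (2::nat) ^ p - 1" "2 ^ p - 1 < n" using p(2) by auto
    moreover have "2 ^ p - 1 \<notin> Z_star n" using none \<open>p > 1\<close> by blast
    moreover have "\<not> coprime x n" if "1 \<le> x" "x < n" "x \<notin> Z_star n" for x
      using that unfolding Z_star_def mem_Collect_eq by (metis coprime_imp_gcd_eq_1)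
    ultimately show "\<not> coprime (2 ^ p - 1) n" by metis
  qed
  \<comment> \<open>All primes up to \<open>L\<close> supply a factor of \<open>n\<close>, and the
    product of these factors exceeds \<open>n\<close>.\<close>
  obtain L where L: "2 ^ L \<le> n" "n < 2 ^ (L + 1)"
    using ex_power_ivl1[of 2 n] assms by auto
  have "2 ^ 400 < (2::nat) ^ (L + 1)"
    using obstructed_ge_power_400[OF \<open>obstructed n\<close> assms] L(2) by (rule le_less_trans)
  then have "400 < L + 1" by (rule power_less_imp_less_exp[rotated]) simp
  then have "2 ^ (L + 1) \<le> (\<Prod>p | prime p \<and> p \<le> L. factor_bound p)"
    by (intro prod_factor_bound_ge) simp
  also have "\<dots> \<le> n"
  proof (rule prod_factor_bound_le[OF \<open>obstructed n\<close>])
    show "2 ^ p \<le> n" if "p \<in> {p. prime p \<and> p \<le> L}" for p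
    proof -
      have "(2::nat) ^ p \<le> 2 ^ L" using that by (intro power_increasing) auto
      then show ?thesis using L(1) by (rule order_trans)
    qed
  qed (use assms in auto)
  finally show False using L(2) by simp
qed

end
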